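(* Let $a,b,\ell$ be positive integers and define $\beta:[a]\times[b]\to\mathbb{Z}$ by $\beta(i,j)=b+2i-1$. Then there is a bijection $\Psi:\mathcal{L}_{([a]\times[b])\times[\ell]}(R^\beta)\to\mathcal{L}_{\triangle_a\times[\ell]}(R^{a+b})$ with $\Psi\circ\mathrm{Pro}=\mathrm{Pro}\circ\Psi$.
   Context: For a finite poset $P$ and positive integer $\ell$, let $[\ell]=\{1<\dots<\ell\}$ and for $p\in P$ let the fiber be $F_p=\{(p,i):1\le i\le \ell\}$. Given $R$ assigning to each $p\in P$ a finite nonempty set $R(p)\subset\mathbb{Z}$, a $P$-strict labeling of $P\times[\ell]$ with restriction function $R$ is a map $f:P\times[\ell]\to\mathbb{Z}$ with (1) $f(p_1,i)<f(p_2,i)$ whenever $p_1<_P p_2$; (2) $f(p,i_1)\le f(p,i_2)$ whenever $i_1\le i_2$; (3) $f(p,i)\in R(p)$. The set of these is $\mathcal{L}_{P\times[\ell]}(R)$. For an upper bound function $\beta:P\to\mathbb{Z}$, $R^\beta(p)$ is the set of $k$ such that some map $g:P\to\mathbb{Z}$ with $g(p_1)<g(p_2)$ whenever $p_1<_Pp_2$ and $1\le g(p')\le\beta(p')$ for all $p'\in P$ has $g(p)=k$; $R^q$ for an integer $q$ is $R^\beta$ with $\beta$ constantly $q$. $[a]\times[b]$ has the componentwise order, and $\triangle_a$ is the subposet $\{(i,j):1\le i\le a,\ a-i+1\le j\le a\}$ of $[a]\times[a]$ with the induced componentwise order. Promotion: let $R(p)_{>k}$ be the smallest element of $R(p)$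 larger than $k$. A label $f(p,i)$ is raisable (resp. lowerable) if there is $g\in\mathcal{L}_{P\times[\ell]}(R)$ with $f(p,i)<g(p,i)$ (resp. $>$) and $f(p',i')=g(p',i')$ for all $(p',i')$ with $p'\neq p$. The Bender–Knuth involution $\rho_k$: call raisable labels equal to $k$ and lowerable labels equal to $R(p)_{>k}$ free; if the free labels in fiber $F_p$ are $\alpha$ copies of $k$ followed by $\beta'$ copies of $R(p)_{>k}$, $\rho_k$ replaces them by $\beta'$ copies of $k$ followed by $\alpha$ copies of $R(p)_{>k}$. Promotion is $\mathrm{Pro}=\cdots\circ\rho_2\circ\rho_1\circ\cdots$ (applied in increasing order of $k$; only finitely many act nontrivially). *)

theory Defs
  imports "HOL-Library.Product_Order" "HOL-Library.FuncSet"
begin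

text \<open>
  A finite poset is a finite set in a type of class \<^class>\<open>order\<close>, with the induced order.
  The theory of componentwise products makes pairs such a type, with
  \<open>(i, j) \<le> (i', j') \<longleftrightarrow> i \<le> i' \<and> j \<le> j'\<close> and \<open>x < y \<longleftrightarrow> x \<le> y \<and> x \<noteq> y\<close>.
  The chain with \<open>l\<close> elements is \<open>{1..l}\<close>.
\<close>

definition triangle :: "nat \<Rightarrow> (nat \<times> nat) set" where
  "triangle a = {(i, j). 1 \<le> i \<and> i \<le> a \<and> a - i + 1 \<le> j \<and> j \<le> a}"

text \<open>
  Labelings are extensional, so that each one is represented by exactly one total function.
\<close>

definition labelings :: "'a::order set \<Rightarrow> nat \<Rightarrow> ('a \<Rightarrow> int set) \<Rightarrow> ('a \<times> nat \<Rightarrow> int) set" where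
  "labelings P l R = {f \<in> extensional (P \<times> {1..l}).
     (\<forall>p1\<in>P. \<forall>p2\<in>P. \<forall>i\<in>{1..l}. p1 < p2 \<longrightarrow> f (p1, i) < f (p2, i)) \<and>
     (\<forall>p\<in>P. \<forall>i1\<in>{1..l}. \<forall>i2\<in>{1..l}. i1 \<le> i2 \<longrightarrow> f (p, i1) \<le> f (p, i2)) \<and>
     (\<forall>p\<in>P. \<forall>i\<in>{1..l}. f (p, i) \<in> R p)}"

definition restriction :: "'a::order set \<Rightarrow> ('a \<Rightarrow> int) \<Rightarrow> 'a \<Rightarrow> int set" where
  "restriction P \<beta> p = {k. \<exists>g :: 'a \<Rightarrow> int.
     (\<forall>p1\<in>P. \<forall>p2\<in>P. p1 < p2 \<longrightarrow> g p1 < g p2) \<and>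
     (\<forall>p'\<in>P. 1 \<le> g p' \<and> g p' \<le> \<beta> p') \<and> g p = k}"

definition next_label :: "('a \<Rightarrow> int set) \<Rightarrow> 'a \<Rightarrow> int \<Rightarrow> int" where
  "next_label R p k = Min {r \<in> R p. k < r}"

definition agree_off_fiber ::
    "'a set \<Rightarrow> nat \<Rightarrow> 'a \<Rightarrow> ('a \<times> nat \<Rightarrow> int) \<Rightarrow> ('a \<times> nat \<Rightarrow> int) \<Rightarrow> bool" where
  "agree_off_fiber P l p f g \<longleftrightarrow> (\<forall>p'\<in>P. \<forall>i\<in>{1..l}. p' \<noteq> p \<longrightarrow> f (p', i) = g (p', i))"

definition raisable ::
    "'a::order set \<Rightarrow> nat \<Rightarrow> ('a \<Rightarrow> int set) \<Rightarrow> ('a \<times> nat \<Rightarrow> int) \<Rightarrow> 'a \<Rightarrow> nat \<Rightarrow> bool" where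
  "raisable P l R f p i \<longleftrightarrow>
     (\<exists>g\<in>labelings P l R. f (p, i) < g (p, i) \<and> agree_off_fiber P l p f g)"

definition lowerable ::
    "'a::order set \<Rightarrow> nat \<Rightarrow> ('a \<Rightarrow> int set) \<Rightarrow> ('a \<times> nat \<Rightarrow> int) \<Rightarrow> 'a \<Rightarrow> nat \<Rightarrow> bool" where
  "lowerable P l R f p i \<longleftrightarrow>
     (\<exists>g\<in>labelings P l R. g (p, i) < f (p, i) \<and> agree_off_fiber P l p f g)"

text \<open>
  The layers at which the fiber of \<open>p\<close> has a free label for the \<open>k\<close>-th involution, separately for
  the two values.  There are none unless \<open>k\<close> and some larger integer both belong to \<open>R p\<close>;
  in particular \<^const>\<open>next_label\<close> is only used where the minimum exists.
\<close>

definition free_low ::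
    "'a::order set \<Rightarrow> nat \<Rightarrow> ('a \<Rightarrow> int set) \<Rightarrow> int \<Rightarrow> ('a \<times> nat \<Rightarrow> int) \<Rightarrow> 'a \<Rightarrow> nat set" where
  "free_low P l R k f p = {i \<in> {1..l}. k \<in> R p \<and> (\<exists>r\<in>R p. k < r) \<and>
     f (p, i) = k \<and> raisable P l R f p i}"

definition free_high ::
    "'a::order set \<Rightarrow> nat \<Rightarrow> ('a \<Rightarrow> int set) \<Rightarrow> int \<Rightarrow> ('a \<times> nat \<Rightarrow> int) \<Rightarrow> 'a \<Rightarrow> nat set" where
  "free_high P l R k f p = {i \<in> {1..l}. k \<in> R p \<and> (\<exists>r\<in>R p. k < r) \<and>
     f (p, i) = next_label R p k \<and> lowerable P l R f p i}"

text \<open>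
  With \<open>\<alpha>\<close> free labels \<open>k\<close> and \<open>\<beta>'\<close> free labels \<open>next_label R p k\<close> in the fiber of \<open>p\<close>, the first
  \<open>\<beta>'\<close> free layers receive \<open>k\<close> and the remaining \<open>\<alpha>\<close> receive \<open>next_label R p k\<close>.  All fibers
  are changed simultaneously, freeness being determined by \<open>f\<close>.
\<close>

definition bender_knuth ::
    "'a::order set \<Rightarrow> nat \<Rightarrow> ('a \<Rightarrow> int set) \<Rightarrow> int \<Rightarrow> ('a \<times> nat \<Rightarrow> int) \<Rightarrow> ('a \<times> nat \<Rightarrow> int)" where
  "bender_knuth P l R k f = (\<lambda>(p, i).
     let F = free_low P l R k f p \<union> free_high P l R k f p in
     if p \<in> P \<and> i \<in> F then
       (if card {i' \<in> F. i' < i} < card (free_high P l R k f p) then k else next_label R p k)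
     else f (p, i))"

text \<open>
  The involutions are composed over the labels that occur in \<open>R\<close>, the smallest being applied first;
  \<open>bender_knuth_trivial\<close> and \<open>promotion_eq_fold\<close> below show that all others are trivial and
  that composing over any larger finite set of integers gives the same map.
\<close>

definition promotion ::
    "'a::order set \<Rightarrow> nat \<Rightarrow> ('a \<Rightarrow> int set) \<Rightarrow> ('a \<times> nat \<Rightarrow> int) \<Rightarrow> ('a \<times> nat \<Rightarrow> int)" where
  "promotion P l R = fold (bender_knuth P l R) (sorted_list_of_set (\<Union>p\<in>P. R p))"

lemma bender_knuth_trivial:
  assumes "k \<notin> (\<Union>p\<in>P. R p)"
  shows "bender_knuth P l R k f = f"
  using assms by (auto simp: bender_knuth_def free_low_def free_high_def Let_def fun_eq_iff)

lemma promotion_eq_fold: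
  assumes "finite K" and "(\<Union>p\<in>P. R p) \<subseteq> K"
  shows "promotion P l R f = fold (bender_knuth P l R) (sorted_list_of_set K) f"
proof -
  let ?U = "\<Union>p\<in>P. R p"
  have "fold (bender_knuth P l R) (filter (\<lambda>k. k \<in> ?U) ks) h = fold (bender_knuth P l R) ks h"
    for ks h
  proof (induction ks arbitrary: h)
    case (Cons k ks)
    then show ?case by (cases "k \<in> ?U") (simp_all add: bender_knuth_trivial)
  qed simp
  moreover have "sorted_list_of_set ?U = filter (\<lambda>k. k \<in> ?U) (sorted_list_of_set K)"
  proof (rule sorted_distinct_set_unique)
    show "set (sorted_list_of_set ?U) = set (filter (\<lambda>k. k \<in> ?U) (sorted_list_of_set K))"
      using assms finite_subset[OF assms(2,1)] by auto
  qed (simp_all add: sorted_wrt_filter del: UN_iff)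
  ultimately show ?thesis
    by (simp only: promotion_def)
qed

end

theory Submission
  imports Defs
begin

text \<open>
  Counting for each \<open>p\<close> and \<open>k\<close> the labels at most \<open>k\<close> in the fiber of \<open>p\<close> turns a labeling into a
  bounded order-reversing function on the cells \<open>(p, k)\<close>, and the \<open>k\<close>-th Bender--Knuth involution into
  the simultaneous piecewise-linear toggle of all cells \<open>(p, k)\<close>.  Promotion thus sweeps through the
  cells along the height function \<open>k\<close>, which changes by 1 along every edge.  For both labeling problems
  the cells form the product of the triangle with a chain of \<open>b\<close> elements; only the height functions
  differ.  Raising a local minimum of a height function by 2 conjugates the sweep by a single toggle,
  and such steps lead from one height function to a translate of the other.
\<close>

section \<open>Toggles and sweeps\<close>

text \<open>An edge \<open>E q r\<close> stands for the constraint that the value at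
  \<open>r\<close> is at most the value at \<open>q\<close>. The toggle reflects a value in the
  interval that its neighbours allow, with 0 and \<open>l\<close> as default bounds; all vertices of
  \<open>X\<close> read the old \<open>s\<close>.\<close>

definition toggle_set :: "('q \<Rightarrow> 'q \<Rightarrow> bool) \<Rightarrow> int \<Rightarrow> 'q set \<Rightarrow> ('q \<Rightarrow> int) \<Rightarrow> 'q \<Rightarrow> int" where
  "toggle_set E l X s = (\<lambda>q. if q \<in> X
     then Max (insert 0 (s ` {r. E q r})) + Min (insert l (s ` {r. E r q})) - s q else s q)"

definition bounded_partitions :: "'q set \<Rightarrow> ('q \<Rightarrow> 'q \<Rightarrow> bool) \<Rightarrow> int \<Rightarrow> ('q \<Rightarrow> int) set" where
  "bounded_partitions Q E l = {s \<in> extensional Q.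
     (\<forall>q\<in>Q. 0 \<le> s q \<and> s q \<le> l) \<and> (\<forall>q r. E q r \<longrightarrow> s r \<le> s q)}"

definition sweep :: "'q set \<Rightarrow> ('q \<Rightarrow> 'q \<Rightarrow> bool) \<Rightarrow> int \<Rightarrow> ('q \<Rightarrow> int) \<Rightarrow> int list \<Rightarrow>
    ('q \<Rightarrow> int) \<Rightarrow> 'q \<Rightarrow> int" where
  "sweep Q E l h = fold (\<lambda>k. toggle_set E l {q \<in> Q. h q = k})"

text \<open>Without edges between \<open>X\<close> and \<open>Y\<close>, toggling \<open>Y\<close>
  changes neither a vertex of \<open>X\<close> nor a neighbour of one.\<close>

lemma toggle_set_Un:
  assumes "X \<inter> Y = {}" and "\<And>q r. E q r \<Longrightarrow> \<not> (q \<in> X \<and> r \<in> Y) \<and> \<not> (q \<in> Y \<and> r \<in> X)"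
  shows "toggle_set E l (X \<union> Y) s = toggle_set E l X (toggle_set E l Y s)"
proof
  fix q
  have "toggle_set E l Y s ` {r. E q r} = s ` {r. E q r}"
    "toggle_set E l Y s ` {r. E r q} = s ` {r. E r q}" if "q \<in> X"
    using assms(2) that by (auto simp: toggle_set_def intro!: image_cong)
  then show "toggle_set E l (X \<union> Y) s q = toggle_set E l X (toggle_set E l Y s) q"
    using assms(1) by (auto simp: toggle_set_def)
qed

lemma toggle_set_involution:
  assumes "\<And>q r. E q r \<Longrightarrow> \<not> (q \<in> X \<and> r \<in> X)"
  shows "toggle_set E l X (toggle_set E l X s) = s"
proof
  fix q
  have "toggle_set E l X s ` {r. E q r} = s ` {r. E q r}"
    "toggle_set E l X s ` {r. E r q} = s ` {r. E r q}" if "q \<in> X"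
    using assms that by (auto simp: toggle_set_def intro!: image_cong)
  then show "toggle_set E l X (toggle_set E l X s) q = s q"
    by (cases "q \<in> X") (simp_all add: toggle_set_def)
qed

lemma sweep_cong:
  assumes "\<And>k. k \<in> set ks \<Longrightarrow> {q \<in> Q. h q = k} = {q \<in> Q. h' q = k}"
  shows "sweep Q E l h ks s = sweep Q E l h' ks s"
  unfolding sweep_def by (intro fold_cong) (simp_all add: assms)

text \<open>No level in \<open>ks\<close> meets \<open>X\<close> or has an edge to it, so the toggle
  of the union of the level with \<open>X\<close> splits in either order.\<close>

lemma sweep_toggle_set_commute:
  assumes "\<And>q r. E q r \<Longrightarrow> q \<in> X \<Longrightarrow> h r \<notin> set ks" "\<And>q r. E r q \<Longrightarrow> q \<in> X \<Longrightarrow> h r \<notin> set ks"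
    and "\<And>q. q \<in> X \<Longrightarrow> h q \<notin> set ks"
  shows "sweep Q E l h ks (toggle_set E l X s) = toggle_set E l X (sweep Q E l h ks s)"
  using assms
proof (induction ks arbitrary: s)
  case (Cons k ks)
  let ?L = "{q \<in> Q. h q = k}"
  have "toggle_set E l ?L (toggle_set E l X s) = toggle_set E l (?L \<union> X) s"
    using Cons.prems by (intro toggle_set_Un[symmetric]) fastforce+
  also have "\<dots> = toggle_set E l (X \<union> ?L) s"
    by (simp only: Un_commute)
  also have "\<dots> = toggle_set E l X (toggle_set E l ?L s)"
    using Cons.prems by (intro toggle_set_Un) fastforce+
  finally show ?case
    using Cons by (simp add: sweep_def)
qed (simp add: sweep_def)

lemma sweep_shift:
  "sweep Q E l (\<lambda>q. h q + c) (map (\<lambda>k. k + c) ks) s = sweep Q E l h ks s"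
  by (simp add: sweep_def fold_map comp_def)

text \<open>
  Raising a local minimum \<open>q\<close> of the height function by 2 moves the toggle at \<open>q\<close> from the
  beginning of the sweep to its end.
\<close>

lemma sweep_flip:
  assumes q: "q \<in> Q" and nbr: "\<And>r. E q r \<or> E r q \<Longrightarrow> h r = h q + 1"
    and range: "m \<le> h q" "h q + 2 \<le> n"
  shows "sweep Q E l (h(q := h q + 2)) [m..n] (toggle_set E l {q} s) =
    toggle_set E l {q} (sweep Q E l h [m..n] s)"
proof -
  let ?k = "h q" and ?h = "h(q := h q + 2)"
  let ?t = "toggle_set E l {q}" and ?S = "\<lambda>h k. toggle_set E l {q \<in> Q. h q = k}"
  \<comment> \<open>Only the levels \<open>?k\<close>, \<open>?k + 1\<close> and
    \<open>?k + 2\<close> can contain \<open>q\<close> or a neighbour of it, before or after the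
    raise; the toggle at \<open>q\<close> commutes with the sweep through all other levels.\<close>
  have list: "[m..n] = [m..?k - 1] @ [?k, ?k + 1, ?k + 2] @ [?k + 3..n]"
    using range upto_split1[of m ?k n] upto_rec1[of ?k n] upto_rec1[of "?k + 1" n]
      upto_rec1[of "?k + 2" n] by (simp add: add.commute)
  have sweep_split: "sweep Q E l h' [m..n] s' = sweep Q E l h' [?k + 3..n] (?S h' (?k + 2)
      (?S h' (?k + 1) (?S h' ?k (sweep Q E l h' [m..?k - 1] s'))))" for h' s'
    by (simp add: list sweep_def)
  have other: "sweep Q E l ?h ks (?t s') = ?t (sweep Q E l h ks s')"
    if "?k \<notin> set ks" "?k + 1 \<notin> set ks" "?k + 2 \<notin> set ks" for ks s'
  proof -
    have "sweep Q E l ?h ks (?t s') = sweep Q E l h ks (?t s')"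
      using that by (intro sweep_cong) auto
    also have "\<dots> = ?t (sweep Q E l h ks s')"
      using that nbr by (intro sweep_toggle_set_commute) auto
    finally show ?thesis .
  qed
  \<comment> \<open>All neighbours of \<open>q\<close> have height \<open>?k + 1\<close>, so
    \<open>q\<close> can be split off from the levels \<open>?k\<close> and \<open>?k + 2\<close>.
    The extra toggle is absorbed at level \<open>?k\<close>, whose old version contains
    \<open>q\<close>, and reappears at level \<open>?k + 2\<close>, to which \<open>q\<close> has
    moved.\<close>
  have S0: "?S ?h ?k (?t s') = ?S h ?k s'" for s'
  proof -
    have "{r \<in> Q. h r = ?k} = {r \<in> Q. ?h r = ?k} \<union> {q}"
      using q by auto
    moreover have "toggle_set E l ({r \<in> Q. ?h r = ?k} \<union> {q}) s' = ?S ?h ?k (?t s')"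
    proof (rule toggle_set_Un)
      fix r r' assume "E r r'"
      then show "\<not> (r \<in> {r \<in> Q. ?h r = ?k} \<and> r' \<in> {q}) \<and> \<not> (r \<in> {q} \<and> r' \<in> {r \<in> Q. ?h r = ?k})"
        using nbr[of r] nbr[of r'] by auto
    qed auto
    ultimately show ?thesis
      by simp
  qed
  have S1: "?S ?h (?k + 1) s' = ?S h (?k + 1) s'" for s'
    by (rule arg_cong[where f = "\<lambda>X. toggle_set E l X s'"]) auto
  have S2: "?S ?h (?k + 2) s' = ?t (?S h (?k + 2) s')" for s'
  proof -
    have "{r \<in> Q. ?h r = ?k + 2} = {q} \<union> {r \<in> Q. h r = ?k + 2}"
      using q by auto
    moreover have "toggle_set E l ({q} \<union> {r \<in> Q. h r = ?k + 2}) s' = ?t (?S h (?k + 2) s')"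
    proof (rule toggle_set_Un)
      fix r r' assume "E r r'"
      then show "\<not> (r \<in> {q} \<and> r' \<in> {r \<in> Q. h r = ?k + 2}) \<and> \<not> (r \<in> {r \<in> Q. h r = ?k + 2} \<and> r' \<in> {q})"
        using nbr[of r] nbr[of r'] by auto
    qed auto
    ultimately show ?thesis
      by simp
  qed
  have low: "sweep Q E l ?h [m..?k - 1] (?t s) = ?t (sweep Q E l h [m..?k - 1] s)"
    and high: "sweep Q E l ?h [?k + 3..n] (?t s') = ?t (sweep Q E l h [?k + 3..n] s')" for s'
    by (rule other; simp)+
  show ?thesis
    unfolding sweep_split low S0 S1 S2 high ..
qed

section \<open>Conjugacy of sweeps along different height functions\<close>

locale toggle_graph =
  fixes Q :: "'q set" and E :: "'q \<Rightarrow> 'q \<Rightarrow> bool" and l :: int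
  assumes finite_vertices: "finite Q"
    and edge_vertices: "E q r \<Longrightarrow> q \<in> Q \<and> r \<in> Q"
begin

lemma finite_neighbours: "finite {r. E q r}" "finite {r. E r q}"
  by (rule finite_subset[OF _ finite_vertices]; use edge_vertices in auto)+

lemma bounds_of_partition:
  assumes "s \<in> bounded_partitions Q E l" and "q \<in> Q"
  shows "Max (insert 0 (s ` {r. E q r})) \<le> s q" "s q \<le> Min (insert l (s ` {r. E r q}))"
  using assms finite_neighbours by (auto simp: bounded_partitions_def)

text \<open>A reflected value stays between the bounds given by its neighbours, and these bounds do
  not move because no edge has both ends in \<open>X\<close>.\<close>

lemma toggle_set_partition:
  assumes s: "s \<in> bounded_partitions Q E l" and X: "X \<subseteq> Q"
    and indep: "\<And>q r. E q r \<Longrightarrow> \<not> (q \<in> X \<and> r \<in> X)"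
  shows "toggle_set E l X s \<in> bounded_partitions Q E l"
proof -
  let ?A = "\<lambda>q. Max (insert 0 (s ` {r. E q r}))" and ?B = "\<lambda>q. Min (insert l (s ` {r. E r q}))"
  have AB: "0 \<le> ?A q" "?B q \<le> l" for q
    using finite_neighbours by auto
  have edge: "s r \<le> ?A q" "?B r \<le> s q" if "E q r" for q r
    using that finite_neighbours by (auto intro!: Max_ge Min_le)
  have val: "toggle_set E l X s q = (if q \<in> X then ?A q + ?B q - s q else s q)" for q
    by (simp add: toggle_set_def)
  have range: "?A q \<le> s q" "s q \<le> ?B q" if "q \<in> Q" for q
    using bounds_of_partition[OF s that] .
  have "0 \<le> toggle_set E l X s q \<and> toggle_set E l X s q \<le> l" if "q \<in> Q" for q
    using range[OF that] AB[of q] unfolding val by auto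
  moreover have "toggle_set E l X s r \<le> toggle_set E l X s q" if "E q r" for q r
  proof -
    have "s r \<le> s q"
      using s that by (auto simp: bounded_partitions_def)
    then show ?thesis
      using range[of q] range[of r] edge[OF that] edge_vertices[OF that] indep[OF that]
      unfolding val by auto
  qed
  moreover have "toggle_set E l X s \<in> extensional Q"
    using s X by (auto simp: bounded_partitions_def extensional_def toggle_set_def)
  ultimately show ?thesis
    by (simp add: bounded_partitions_def)
qed

lemma bij_betw_toggle:
  assumes "q \<in> Q" and "\<not> E q q"
  shows "bij_betw (toggle_set E l {q}) (bounded_partitions Q E l) (bounded_partitions Q E l)"
\<comment> \<open>A toggle is its own inverse, so the four obligations come in two identical
  pairs.\<close>
proof (rule bij_betw_byWitness[where f' = "toggle_set E l {q}"])
  have indep: "\<not> (r \<in> {q} \<and> r' \<in> {q})" if "E r r'" for r r'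
    using assms(2) that by auto
  show "\<forall>s\<in>bounded_partitions Q E l. toggle_set E l {q} (toggle_set E l {q} s) = s"
    using toggle_set_involution[of E "{q}"] indep by blast
  then show "\<forall>s\<in>bounded_partitions Q E l. toggle_set E l {q} (toggle_set E l {q} s) = s" .
  show "toggle_set E l {q} ` bounded_partitions Q E l \<subseteq> bounded_partitions Q E l"
    using toggle_set_partition[of _ "{q}"] indep assms(1) by blast
  then show "toggle_set E l {q} ` bounded_partitions Q E l \<subseteq> bounded_partitions Q E l" .
qed

text \<open>\<open>d\<close> says how often each vertex has to be raised by 2. By induction on the
  total, a lowest vertex among those still to be raised is flipped, and the toggles at the
  successive vertices compose to the conjugating bijection.\<close>

lemma sweeps_conjugate:
  assumes "\<And>q r. E q r \<Longrightarrow> \<bar>h q - h r\<bar> = 1"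
    and "\<And>q r. E q r \<Longrightarrow> \<bar>h' q - h' r\<bar> = 1"
    and "\<And>q. q \<in> Q \<Longrightarrow> h' q = h q + 2 * int (d q)"
    and "\<And>q. q \<in> Q \<Longrightarrow> m \<le> h q" "\<And>q. q \<in> Q \<Longrightarrow> h' q \<le> n"
  shows "\<exists>\<phi>. bij_betw \<phi> (bounded_partitions Q E l) (bounded_partitions Q E l) \<and>
    (\<forall>s. \<phi> (sweep Q E l h [m..n] s) = sweep Q E l h' [m..n] (\<phi> s))"
  using assms
proof (induction "sum d Q" arbitrary: h d)
  case 0
  then have "h' q = h q" if "q \<in> Q" for q
    using that finite_vertices by auto
  then have "sweep Q E l h [m..n] s = sweep Q E l h' [m..n] s" for s
    by (intro sweep_cong) auto
  then show ?case
    using bij_betw_id[of "bounded_partitions Q E l"] by (intro exI[of _ id]) (simp add: id_def)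
next
  case (Suc N)
  define Y where "Y = {q \<in> Q. d q \<noteq> 0}"
  have "\<exists>q\<in>Q. d q \<noteq> 0"
    using Suc.hyps(2) by (metis nat.distinct(1) sum.neutral)
  then have Y: "finite Y" "Y \<noteq> {}"
    using finite_vertices by (auto simp: Y_def)
  define q where "q = arg_min_on h Y"
  have q: "q \<in> Q" "d q \<noteq> 0" and min: "\<And>r. r \<in> Y \<Longrightarrow> h q \<le> h r"
    using arg_min_if_finite[OF Y, of h] unfolding q_def[symmetric] by (auto simp: Y_def not_less)
  \<comment> \<open>A neighbour below \<open>q\<close> would already have its final height by the
    choice of \<open>q\<close>. As heights under \<open>h'\<close> differ by 1 along edges, this
    would give \<open>h' q \<le> h q\<close>, against \<open>d q \<noteq> 0\<close>.\<close>
  have nbr: "h r = h q + 1" if E: "E q r \<or> E r q" for r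
  proof (rule ccontr)
    assume "h r \<noteq> h q + 1"
    then have r: "h r = h q - 1"
      using E Suc.prems(1)[of q r] Suc.prems(1)[of r q] by linarith
    have "r \<in> Q"
      using E edge_vertices by blast
    then have "h' r = h r"
      using r min[of r] Suc.prems(3)[of r] by (auto simp: Y_def)
    then have "h' q \<le> h q"
      using r E Suc.prems(2)[of q r] Suc.prems(2)[of r q] by linarith
    then show False
      using q Suc.prems(3)[of q] by auto
  qed
  let ?h = "h(q := h q + 2)" and ?d = "d(q := d q - 1)"
  have irr: "\<not> E q q"
    using nbr[of q] by auto
  have flip: "sweep Q E l ?h [m..n] (toggle_set E l {q} s) =
      toggle_set E l {q} (sweep Q E l h [m..n] s)" for s
    using q nbr Suc.prems(3)[of q] Suc.prems(4)[of q] Suc.prems(5)[of q]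
    by (intro sweep_flip) auto
  have "N = sum ?d Q"
    using Suc.hyps(2) q finite_vertices
    by (simp add: sum.remove[of Q q] cong: sum.cong_simp)
  moreover have "\<bar>?h r - ?h r'\<bar> = 1" if "E r r'" for r r'
    using that nbr[of r] nbr[of r'] irr Suc.prems(1)[of r r'] by auto
  moreover have "h' r = ?h r + 2 * int (?d r)" if "r \<in> Q" for r
    using that q Suc.prems(3)[of r] by auto
  moreover have "m \<le> ?h r" if "r \<in> Q" for r
    using that Suc.prems(4)[of r] by auto
  ultimately obtain \<phi> where bij: "bij_betw \<phi> (bounded_partitions Q E l) (bounded_partitions Q E l)"
    and \<phi>: "\<And>s. \<phi> (sweep Q E l ?h [m..n] s) = sweep Q E l h' [m..n] (\<phi> s)"
    using Suc.hyps(1)[of ?d ?h] Suc.prems(2,5) by blast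
  have "\<phi> (toggle_set E l {q} (sweep Q E l h [m..n] s)) =
      sweep Q E l h' [m..n] (\<phi> (toggle_set E l {q} s))" for s
    by (simp only: flip[symmetric] \<phi>)
  then show ?case
    using bij_betw_trans[OF bij_betw_toggle[OF q(1) irr] bij] by (intro exI[of _ "\<phi> \<circ> toggle_set E l {q}"]) simp
qed

end

section \<open>Transport along graph isomorphisms\<close>

lemma transport_sweep:
  assumes bij: "bij_betw \<theta> Q' Q"
    and edge: "\<And>q r. q \<in> Q' \<Longrightarrow> r \<in> Q' \<Longrightarrow> E' q r \<longleftrightarrow> E (\<theta> q) (\<theta> r)"
    and E: "\<And>q r. E q r \<Longrightarrow> q \<in> Q \<and> r \<in> Q" and E': "\<And>q r. E' q r \<Longrightarrow> q \<in> Q' \<and> r \<in> Q'"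
  defines "\<tau> \<equiv> \<lambda>s. restrict (s \<circ> \<theta>) Q'"
  shows "bij_betw \<tau> (bounded_partitions Q E l) (bounded_partitions Q' E' l)"
    and "\<tau> (sweep Q E l h ks s) = sweep Q' E' l (h \<circ> \<theta>) ks (\<tau> s)"
proof -
  let ?\<theta>' = "inv_into Q' \<theta>"
  have \<theta>: "\<And>q. q \<in> Q' \<Longrightarrow> \<theta> q \<in> Q" "\<And>q. q \<in> Q' \<Longrightarrow> ?\<theta>' (\<theta> q) = q"
    "\<And>q. q \<in> Q \<Longrightarrow> ?\<theta>' q \<in> Q'" "\<And>q. q \<in> Q \<Longrightarrow> \<theta> (?\<theta>' q) = q"
    by (fact bij_betw_apply[OF bij] bij_betw_inv_into_left[OF bij]
        bij_betw_apply[OF bij_betw_inv_into[OF bij]] bij_betw_inv_into_right[OF bij])+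
  show "bij_betw \<tau> (bounded_partitions Q E l) (bounded_partitions Q' E' l)"
  proof (rule bij_betw_byWitness[where f' = "\<lambda>s. restrict (s \<circ> ?\<theta>') Q"])
    show "\<forall>s\<in>bounded_partitions Q E l. restrict (\<tau> s \<circ> ?\<theta>') Q = s"
      by (auto simp: \<tau>_def \<theta> bounded_partitions_def fun_eq_iff extensional_def)
    show "\<forall>s\<in>bounded_partitions Q' E' l. \<tau> (restrict (s \<circ> ?\<theta>') Q) = s"
      by (auto simp: \<tau>_def \<theta> bounded_partitions_def fun_eq_iff extensional_def)
    show "\<tau> ` bounded_partitions Q E l \<subseteq> bounded_partitions Q' E' l"
    proof (intro image_subsetI)
      fix s assume s: "s \<in> bounded_partitions Q E l"
      have "\<tau> s r \<le> \<tau> s q" if "E' q r" for q r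
        using s E'[OF that] edge[of q r] that by (simp add: \<tau>_def bounded_partitions_def)
      then show "\<tau> s \<in> bounded_partitions Q' E' l"
        using s \<theta>(1) by (simp add: bounded_partitions_def) (simp add: \<tau>_def)
    qed
    show "(\<lambda>s. restrict (s \<circ> ?\<theta>') Q) ` bounded_partitions Q' E' l \<subseteq> bounded_partitions Q E l"
    proof (intro image_subsetI)
      fix s assume s: "s \<in> bounded_partitions Q' E' l"
      have "s (?\<theta>' r) \<le> s (?\<theta>' q)" if "E q r" for q r
        using s E[OF that] edge[of "?\<theta>' q" "?\<theta>' r"] that by (simp add: \<theta> bounded_partitions_def)
      then show "restrict (s \<circ> ?\<theta>') Q \<in> bounded_partitions Q E l"
        using s \<theta>(3) E by (simp add: bounded_partitions_def)
    qed
  qed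
  have toggle: "\<tau> (toggle_set E l {q \<in> Q. h q = k} s) = toggle_set E' l {q \<in> Q'. (h \<circ> \<theta>) q = k} (\<tau> s)"
    for k s
  proof
    fix q
    have "\<tau> s ` {r. E' q r} = s ` {r. E (\<theta> q) r}" "\<tau> s ` {r. E' r q} = s ` {r. E r (\<theta> q)}" if "q \<in> Q'"
    proof -
      \<comment> \<open>Edges join only vertices, so every neighbour of \<open>\<theta> q\<close> is
        the image of a neighbour of \<open>q\<close>.\<close>
      have "{r. E (\<theta> q) r} = \<theta> ` {r. E' q r}" "{r. E r (\<theta> q)} = \<theta> ` {r. E' r q}"
        using edge[OF that] edge[OF _ that] E E' \<theta>(3,4) that by (auto simp: image_iff) metis+
      then show "\<tau> s ` {r. E' q r} = s ` {r. E (\<theta> q) r}" "\<tau> s ` {r. E' r q} = s ` {r. E r (\<theta> q)}"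
        using E' by (auto simp: \<tau>_def image_image intro!: image_cong)
    qed
    then show "\<tau> (toggle_set E l {q \<in> Q. h q = k} s) q =
        toggle_set E' l {q \<in> Q'. (h \<circ> \<theta>) q = k} (\<tau> s) q"
      by (cases "q \<in> Q'") (simp_all add: toggle_set_def \<tau>_def \<theta>)
  qed
  show "\<tau> (sweep Q E l h ks s) = sweep Q' E' l (h \<circ> \<theta>) ks (\<tau> s)"
    by (induction ks arbitrary: s) (simp_all add: sweep_def toggle[unfolded o_apply])
qed

section \<open>Labelings as partitions\<close>

text \<open>
  The vertices \<open>(p, k)\<close> carry the threshold counts of a labeling: the value at \<open>(p, k)\<close> is the number
  of labels in the fiber of \<open>p\<close> that are at most \<open>k\<close>.  Cells with \<open>k < lo p\<close> or \<open>hi p \<le> k\<close> are left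
  out because their counts are forced.
\<close>

definition cells :: "'a set \<Rightarrow> ('a \<Rightarrow> int) \<Rightarrow> ('a \<Rightarrow> int) \<Rightarrow> ('a \<times> int) set" where
  "cells P lo hi = {(p, k). p \<in> P \<and> lo p \<le> k \<and> k < hi p}"

text \<open>The two kinds of edges encode that counts grow with the threshold, and that
  \<open>f (p, i) < f (q, i)\<close> makes the count of \<open>q\<close> at \<open>k + 1\<close> at
  most that of \<open>p\<close> at \<open>k\<close>. Both kinds change the threshold by 1.\<close>

definition cell_edge :: "'a set \<Rightarrow> ('a \<Rightarrow> int) \<Rightarrow> ('a \<Rightarrow> int) \<Rightarrow> ('a \<Rightarrow> 'a \<Rightarrow> bool) \<Rightarrow>
    'a \<times> int \<Rightarrow> 'a \<times> int \<Rightarrow> bool" where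
  "cell_edge P lo hi cov x y \<longleftrightarrow> x \<in> cells P lo hi \<and> y \<in> cells P lo hi \<and>
     (fst y = fst x \<and> snd y = snd x - 1 \<or> cov (fst x) (fst y) \<and> snd y = snd x + 1)"

lemma initial_segment_eq:
  fixes A :: "nat set"
  assumes "A \<subseteq> {1..n}" and "\<And>i j. j \<in> A \<Longrightarrow> 1 \<le> i \<Longrightarrow> i \<le> j \<Longrightarrow> i \<in> A"
  shows "A = {1..card A}"
proof (cases "A = {}")
  case False
  have fin: "finite A"
    using assms(1) finite_subset by blast
  have "A = {1..Max A}"
  proof (intro set_eqI iffI)
    fix i assume "i \<in> A"
    then show "i \<in> {1..Max A}"
      using assms(1) fin by auto
  next
    fix i assume "i \<in> {1..Max A}"
    then show "i \<in> A"
      using assms(2)[of "Max A" i] Max_in[OF fin False] by auto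
  qed
  then show ?thesis
    by (metis card_atLeastAtMost diff_Suc_1)
qed simp

text \<open>This is the common setting of both problems. Strictly increasing interval ends make the
  forced counts of the omitted cells compatible with all edge inequalities.\<close>

locale interval_labelings =
  fixes P :: "'a::order set" and R :: "'a \<Rightarrow> int set" and lo hi :: "'a \<Rightarrow> int"
    and cov :: "'a \<Rightarrow> 'a \<Rightarrow> bool" and l :: nat
  assumes finite_poset: "finite P"
    and R_eq: "p \<in> P \<Longrightarrow> R p = {lo p..hi p}"
    and lo_le_hi: "p \<in> P \<Longrightarrow> lo p \<le> hi p"
    and lo_less: "p \<in> P \<Longrightarrow> q \<in> P \<Longrightarrow> p < q \<Longrightarrow> lo p < lo q"
    and hi_less: "p \<in> P \<Longrightarrow> q \<in> P \<Longrightarrow> p < q \<Longrightarrow> hi p < hi q"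
    and cov_less: "cov p q \<Longrightarrow> p \<in> P \<and> q \<in> P \<and> p < q"
    and cov_above: "p \<in> P \<Longrightarrow> q \<in> P \<Longrightarrow> p < q \<Longrightarrow> \<exists>u. cov p u \<and> u \<le> q"
    and cov_below: "p \<in> P \<Longrightarrow> q \<in> P \<Longrightarrow> p < q \<Longrightarrow> \<exists>u. cov u q \<and> p \<le> u"
begin

abbreviation "L \<equiv> labelings P l R"
abbreviation "Q \<equiv> cells P lo hi"
abbreviation "E \<equiv> cell_edge P lo hi cov"
abbreviation "S \<equiv> bounded_partitions Q E (int l)"

lemma finite_cells: "finite Q"
proof (rule finite_subset)
  show "Q \<subseteq> Sigma P (\<lambda>p. {lo p..<hi p})"
    by (auto simp: cells_def)
qed (simp add: finite_poset)

sublocale toggle_graph Q E "int l"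
  by unfold_locales (auto simp: finite_cells cell_edge_def)

lemma labelingsD:
  assumes "f \<in> L" and "p \<in> P" and "i \<in> {1..l}"
  shows "lo p \<le> f (p, i)" "f (p, i) \<le> hi p"
    "\<And>j. j \<in> {1..l} \<Longrightarrow> i \<le> j \<Longrightarrow> f (p, i) \<le> f (p, j)"
    "\<And>q. q \<in> P \<Longrightarrow> p < q \<Longrightarrow> f (p, i) < f (q, i)"
proof -
  have "f (p, i) \<in> R p"
    using assms by (auto simp: labelings_def)
  then show "lo p \<le> f (p, i)" "f (p, i) \<le> hi p"
    using R_eq assms by auto
qed (use assms in \<open>auto simp: labelings_def\<close>)

text \<open>Strictness along \<open>cov\<close> suffices, since \<open>cov\<close> steps lead from
  \<open>p\<close> up to any larger \<open>q\<close>.\<close>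

lemma labelingsI:
  assumes "f \<in> extensional (P \<times> {1..l})"
    and "\<And>p i. p \<in> P \<Longrightarrow> i \<in> {1..l} \<Longrightarrow> lo p \<le> f (p, i) \<and> f (p, i) \<le> hi p"
    and "\<And>p i j. p \<in> P \<Longrightarrow> i \<in> {1..l} \<Longrightarrow> j \<in> {1..l} \<Longrightarrow> i \<le> j \<Longrightarrow> f (p, i) \<le> f (p, j)"
    and cov: "\<And>p q i. cov p q \<Longrightarrow> i \<in> {1..l} \<Longrightarrow> f (p, i) < f (q, i)"
  shows "f \<in> L"
proof -
  have "f (p, i) < f (q, i)" if "p \<in> P" "q \<in> P" "p < q" "i \<in> {1..l}" for p q i
    using that
  \<comment> \<open>\<open>lo\<close> serves as a rank: it increases strictly with each step up, so
    the difference drops.\<close>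
  proof (induction "nat (lo q - lo p)" arbitrary: p rule: less_induct)
    case less
    then obtain u where u: "cov p u" "u \<le> q"
      using cov_above by blast
    then have "f (p, i) < f (u, i)" "u \<in> P" "p < u"
      using cov cov_less less.prems by auto
    moreover have "f (u, i) < f (q, i)" if "u \<noteq> q"
      using less.hyps[of u] u \<open>u \<in> P\<close> \<open>p < u\<close> that less.prems lo_less[of p u] lo_less[of p q] by auto
    ultimately show ?case
      by fastforce
  qed
  then show ?thesis
    using assms R_eq by (auto simp: labelings_def)
qed

section \<open>The bijection between labelings and bounded partitions\<close>

definition level :: "('a \<times> int \<Rightarrow> int) \<Rightarrow> 'a \<Rightarrow> int \<Rightarrow> int" where
  "level s p k = (if k < lo p then 0 else if hi p \<le> k then int l else s (p, k))"

text \<open>This equivalence, with \<open>level\<close> supplying the forced counts outside the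
  cells, determines labeling and partition from each other. Later arguments use it in place of the
  two explicit maps.\<close>

definition represents :: "('a \<times> nat \<Rightarrow> int) \<Rightarrow> ('a \<times> int \<Rightarrow> int) \<Rightarrow> bool" where
  "represents f s \<longleftrightarrow> f \<in> extensional (P \<times> {1..l}) \<and>
     (\<forall>p\<in>P. \<forall>i\<in>{1..l}. \<forall>k. f (p, i) \<le> k \<longleftrightarrow> int i \<le> level s p k)"

definition to_partition :: "('a \<times> nat \<Rightarrow> int) \<Rightarrow> 'a \<times> int \<Rightarrow> int" where
  "to_partition f = restrict (\<lambda>(p, k). int (card {i \<in> {1..l}. f (p, i) \<le> k})) Q"

definition from_partition :: "('a \<times> int \<Rightarrow> int) \<Rightarrow> 'a \<times> nat \<Rightarrow> int" where
  "from_partition s = restrict (\<lambda>(p, i). lo p + int (card {k \<in> {lo p..<hi p}. s (p, k) < int i}))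
     (P \<times> {1..l})"

lemma level_cell: "(p, k) \<in> Q \<Longrightarrow> level s p k = s (p, k)"
  by (simp add: level_def cells_def)

lemma level_range:
  assumes "s \<in> S" and "p \<in> P"
  shows "0 \<le> level s p k" "level s p k \<le> int l"
  using assms by (auto simp: level_def bounded_partitions_def cells_def)

lemma level_Suc:
  assumes "s \<in> S" and "p \<in> P"
  shows "level s p k \<le> level s p (k + 1)"
proof (cases "lo p \<le> k \<and> k + 1 < hi p")
  case True
  then have "E (p, k + 1) (p, k)"
    using assms by (auto simp: cell_edge_def cells_def)
  then show ?thesis
    using assms True by (auto simp: level_def bounded_partitions_def)
next
  case False
  then show ?thesis
    using level_range[OF assms, of k] level_range[OF assms, of "k + 1"] lo_le_hi[OF assms(2)]
    by (auto simp: level_def)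
qed

lemma level_mono:
  assumes "s \<in> S" and "p \<in> P" and "k \<le> k'"
  shows "level s p k \<le> level s p k'"
  using assms(3)
proof (induction k' rule: int_ge_induct)
  case (step k')
  then show ?case
    using level_Suc[OF assms(1,2), of k'] by simp
qed simp

text \<open>Either both counts belong to cells joined by an edge, or the left one is the forced 0 or
  the right one the forced \<open>l\<close>.\<close>

lemma level_cov:
  assumes "s \<in> S" and "cov p q"
  shows "level s q (k + 1) \<le> level s p k"
proof -
  have *: "p \<in> P" "q \<in> P" "lo p < lo q" "hi p < hi q"
    using assms cov_less lo_less hi_less by blast+
  show ?thesis
  proof (cases "lo q \<le> k + 1 \<and> k < hi p")
    case True
    then have "E (p, k) (q, k + 1)"
      using assms * by (auto simp: cell_edge_def cells_def)
    then show ?thesis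
      using assms True * by (auto simp: level_def bounded_partitions_def)
  next
    case False
    then show ?thesis
      using * level_range[OF assms(1), of q "k + 1"] level_range[OF assms(1), of p k]
      by (auto simp: level_def)
  qed
qed

lemma represents_iff:
  "represents f s \<Longrightarrow> p \<in> P \<Longrightarrow> i \<in> {1..l} \<Longrightarrow> f (p, i) \<le> k \<longleftrightarrow> int i \<le> level s p k"
  by (simp add: represents_def)

lemma represents_labeling:
  assumes s: "s \<in> S" and rep: "represents f s"
  shows "f \<in> L"
proof (rule labelingsI)
  show "f \<in> extensional (P \<times> {1..l})"
    using rep by (simp add: represents_def)
next
  fix p i assume p: "p \<in> P" "i \<in> {1..l}"
  have "level s p (hi p) = int l" "level s p (lo p - 1) = 0"
    using lo_le_hi[OF p(1)] by (auto simp: level_def)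
  then show "lo p \<le> f (p, i) \<and> f (p, i) \<le> hi p"
    using represents_iff[OF rep p, of "hi p"] represents_iff[OF rep p, of "lo p - 1"] p by auto
next
  fix p i j assume p: "p \<in> P" "i \<in> {1..l}" "j \<in> {1..l}" "i \<le> j"
  then show "f (p, i) \<le> f (p, j)"
    using represents_iff[OF rep, of p i "f (p, j)"] represents_iff[OF rep, of p j "f (p, j)"] by simp
next
  fix p q i assume p: "cov p q" "i \<in> {1..l}"
  then show "f (p, i) < f (q, i)"
    \<comment> \<open>The layer \<open>i\<close> is counted for \<open>q\<close> at threshold
      \<open>f (q, i)\<close>, hence for \<open>p\<close> one threshold lower.\<close>
    using represents_iff[OF rep, of p i "f (q, i) - 1"] represents_iff[OF rep, of q i "f (q, i)"]
      level_cov[OF s p(1), of "f (q, i) - 1"] cov_less[OF p(1)] by simp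
qed

text \<open>By monotonicity in the threshold, \<open>?K\<close> is an initial segment of the
  interval; the label is the first threshold at which layer \<open>i\<close> is counted, or
  \<open>hi p\<close> if there is none.\<close>

lemma represents_from_partition:
  assumes s: "s \<in> S"
  shows "represents (from_partition s) s"
  unfolding represents_def
proof (intro conjI ballI allI)
  show "from_partition s \<in> extensional (P \<times> {1..l})"
    by (simp add: from_partition_def)
next
  fix p i k assume p: "p \<in> P" and i: "i \<in> {1..l}"
  let ?K = "{k \<in> {lo p..<hi p}. s (p, k) < int i}"
  have f: "from_partition s (p, i) = lo p + int (card ?K)"
    using p i by (simp add: from_partition_def)
  have "card ?K \<le> card {lo p..<hi p}"
    by (intro card_mono) auto
  then have hi: "lo p + int (card ?K) \<le> hi p"
    using lo_le_hi[OF p] by simp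
  have mono: "s (p, k1) \<le> s (p, k2)" if "lo p \<le> k1" "k1 \<le> k2" "k2 < hi p" for k1 k2
    using level_mono[OF s p that(2)] that by (simp add: level_def)
  consider "k < lo p" | "hi p \<le> k" | "lo p \<le> k" "k < hi p" "int i \<le> s (p, k)"
    | "lo p \<le> k" "k < hi p" "s (p, k) < int i"
    by linarith
  then show "from_partition s (p, i) \<le> k \<longleftrightarrow> int i \<le> level s p k"
  proof cases
    case 3
    have "?K \<subseteq> {lo p..<k}"
    proof
      fix k' assume "k' \<in> ?K"
      then show "k' \<in> {lo p..<k}"
        using mono[of k k'] 3 by force
    qed
    then have "card ?K \<le> card {lo p..<k}"
      by (intro card_mono) auto
    then show ?thesis
      using 3 f by (simp add: level_def)
  next
    case 4
    have "{lo p..k} \<subseteq> ?K"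
    proof
      fix k' assume "k' \<in> {lo p..k}"
      then show "k' \<in> ?K"
        using mono[of k' k] 4 by force
    qed
    moreover have "finite ?K"
      by (rule finite_subset[of _ "{lo p..<hi p}"]) auto
    ultimately have "card {lo p..k} \<le> card ?K"
      by (intro card_mono)
    then show ?thesis
      using 4 f by (simp add: level_def)
  qed (use i f hi lo_le_hi[OF p] in \<open>auto simp: level_def\<close>)
qed

lemma represents_to_partition:
  assumes f: "f \<in> L"
  shows "represents f (to_partition f)" "to_partition f \<in> S"
proof -
  let ?A = "\<lambda>p k. {i \<in> {1..l}. f (p, i) \<le> k}"
  \<comment> \<open>The fiber is weakly increasing, so the layers with labels at most
    \<open>k\<close> form an initial segment, which its size determines.\<close>
  have seg: "f (p, i) \<le> k \<longleftrightarrow> i \<le> card (?A p k)" if "p \<in> P" "i \<in> {1..l}" for p i k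
  proof -
    have "?A p k = {1..card (?A p k)}"
    proof (rule initial_segment_eq)
      fix i j assume "j \<in> ?A p k" "1 \<le> i" "i \<le> j"
      then show "i \<in> ?A p k"
        using labelingsD(3)[OF f \<open>p \<in> P\<close>, of i j] by auto
    qed auto
    then have "i \<in> ?A p k \<longleftrightarrow> i \<in> {1..card (?A p k)}"
      by blast
    then show ?thesis
      using that by auto
  qed
  show "represents f (to_partition f)"
    unfolding represents_def
  proof (intro conjI ballI allI)
    show "f \<in> extensional (P \<times> {1..l})"
      using f by (simp add: labelings_def)
    fix p i k assume p: "p \<in> P" "i \<in> {1..l}"
    show "f (p, i) \<le> k \<longleftrightarrow> int i \<le> level (to_partition f) p k"
      using labelingsD(1,2)[OF f p] p seg[OF p, of k]
      by (auto simp: level_def to_partition_def cells_def)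
  qed
  have "to_partition f y \<le> to_partition f x" if "E x y" for x y
  proof -
    obtain p k q m where x: "x = (p, k)" "y = (q, m)"
      by fastforce
    then have c: "(p, k) \<in> Q" "(q, m) \<in> Q" and e: "q = p \<and> m = k - 1 \<or> cov p q \<and> m = k + 1"
      using that by (auto simp: cell_edge_def)
    have "?A q m \<subseteq> ?A p k"
      using e labelingsD(4)[OF f, of p _ q] cov_less[of p q] by fastforce
    then have "card (?A q m) \<le> card (?A p k)"
      by (intro card_mono) auto
    then show ?thesis
      using c x by (simp add: to_partition_def)
  qed
  moreover have "card (?A p k) \<le> l" for p k
    using card_mono[of "{1..l}" "?A p k"] by (simp add: subset_iff)
  ultimately show "to_partition f \<in> S"
    by (auto simp: bounded_partitions_def to_partition_def)
qed

lemma represents_unique_labeling: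
  assumes "represents f s" and "represents g s"
  shows "f = g"
proof (rule extensionalityI[of _ "P \<times> {1..l}"])
  fix x assume "x \<in> P \<times> {1..l}"
  then obtain p i where "x = (p, i)" "p \<in> P" "i \<in> {1..l}"
    by auto
  then show "f x = g x"
    using represents_iff[OF assms(1), of p i] represents_iff[OF assms(2), of p i]
    by (metis order.antisym order.refl)
qed (use assms in \<open>auto simp: represents_def\<close>)

lemma represents_unique_partition:
  assumes "represents f s" and "represents f s'" and S: "s \<in> S" "s' \<in> S"
  shows "s = s'"
proof (rule extensionalityI[of _ Q])
  fix x assume "x \<in> Q"
  then obtain p k where x: "x = (p, k)" "(p, k) \<in> Q" "p \<in> P"
    by (auto simp: cells_def)
  have "int i \<le> s x \<longleftrightarrow> int i \<le> s' x" if "i \<in> {1..l}" for i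
    using represents_iff[OF assms(1) x(3) that, of k] represents_iff[OF assms(2) x(3) that, of k]
    by (simp add: level_cell x)
  \<comment> \<open>Two numbers in \<open>{0..l}\<close> are equal if each positive one of them is
    bounded by the other.\<close>
  from this[of "nat (s x)"] this[of "nat (s' x)"] show "s x = s' x"
    using level_range[OF S(1) x(3), of k] level_range[OF S(2) x(3), of k]
    unfolding x level_cell[OF x(2)] atLeastAtMost_iff by linarith
qed (use S in \<open>auto simp: bounded_partitions_def\<close>)

lemma bij_betw_to_partition: "bij_betw to_partition L S"
proof (rule bij_betw_byWitness[where f' = from_partition])
  show "\<forall>f\<in>L. from_partition (to_partition f) = f"
    using represents_to_partition represents_from_partition represents_unique_labeling by blast
  show "\<forall>s\<in>S. to_partition (from_partition s) = s"
    using represents_to_partition represents_from_partition represents_labeling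
      represents_unique_partition by blast
  show "to_partition ` L \<subseteq> S" "from_partition ` S \<subseteq> L"
    using represents_to_partition represents_from_partition represents_labeling by blast+
qed

section \<open>Bender-Knuth involutions as toggles\<close>

text \<open>Raisability allows the whole fiber to change, but only the constraints at layer
  \<open>i\<close> matter: in later layers the labels above \<open>p\<close> are at least as
  large.\<close>

lemma raisable_iff:
  assumes f: "f \<in> L" and p: "p \<in> P" and i: "i \<in> {1..l}" and less: "f (p, i) < hi p"
  shows "raisable P l R f p i \<longleftrightarrow> (\<forall>u. cov p u \<longrightarrow> f (p, i) + 1 < f (u, i))"
proof
  assume "raisable P l R f p i"
  then obtain g where g: "g \<in> L" "f (p, i) < g (p, i)" "agree_off_fiber P l p f g"
    by (auto simp: raisable_def)
  show "\<forall>u. cov p u \<longrightarrow> f (p, i) + 1 < f (u, i)"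
  proof (intro allI impI)
    fix u assume "cov p u"
    then have u: "u \<in> P" "p < u"
      using cov_less by auto
    then have "f (u, i) = g (u, i)"
      using g(3) i by (auto simp: agree_off_fiber_def)
    then show "f (p, i) + 1 < f (u, i)"
      using labelingsD(4)[OF g(1) p i u] g(2) by simp
  qed
next
  assume up: "\<forall>u. cov p u \<longrightarrow> f (p, i) + 1 < f (u, i)"
  \<comment> \<open>Raising layer \<open>i\<close> by 1 pushes up exactly those later labels in the
    fiber that equal \<open>f (p, i)\<close>.\<close>
  define g where "g = (\<lambda>(q, j). if q = p \<and> i \<le> j \<and> j \<le> l then max (f (p, j)) (f (p, i) + 1) else f (q, j))"
  have "g \<in> L"
  proof (rule labelingsI)
    show "g \<in> extensional (P \<times> {1..l})"
      using f p i by (auto simp: labelings_def extensional_def g_def)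
  next
    fix q j assume "q \<in> P" "j \<in> {1..l}"
    then show "lo q \<le> g (q, j) \<and> g (q, j) \<le> hi q"
      using labelingsD(1,2)[OF f, of q j] less by (auto simp: g_def)
  next
    fix q j j' assume "q \<in> P" "j \<in> {1..l}" "j' \<in> {1..l}" "j \<le> j'"
    then show "g (q, j) \<le> g (q, j')"
      using labelingsD(3)[OF f, of q j j'] by (auto simp: g_def)
  next
    fix q u j assume q: "cov q u" "j \<in> {1..l}"
    then have "f (q, j) < f (u, j)" "q \<noteq> u"
      using labelingsD(4)[OF f, of q j u] cov_less by auto
    moreover have "f (p, i) + 1 < f (u, j)" if "q = p" "i \<le> j"
      using up q i that labelingsD(3)[OF f, of u i j] cov_less[OF q(1)] by fastforce
    ultimately show "g (q, j) < g (u, j)"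
      by (auto simp: g_def)
  qed
  then show "raisable P l R f p i"
    using i by (auto simp: raisable_def agree_off_fiber_def g_def intro!: bexI[of _ g])
qed

lemma lowerable_iff:
  assumes f: "f \<in> L" and p: "p \<in> P" and i: "i \<in> {1..l}" and less: "lo p < f (p, i)"
  shows "lowerable P l R f p i \<longleftrightarrow> (\<forall>u. cov u p \<longrightarrow> f (u, i) < f (p, i) - 1)"
proof
  assume "lowerable P l R f p i"
  then obtain g where g: "g \<in> L" "g (p, i) < f (p, i)" "agree_off_fiber P l p f g"
    by (auto simp: lowerable_def)
  show "\<forall>u. cov u p \<longrightarrow> f (u, i) < f (p, i) - 1"
  proof (intro allI impI)
    fix u assume "cov u p"
    then have u: "u \<in> P" "u < p"
      using cov_less by auto
    then have "f (u, i) = g (u, i)"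
      using g(3) i by (auto simp: agree_off_fiber_def)
    then show "f (u, i) < f (p, i) - 1"
      using labelingsD(4)[OF g(1) u(1) i p u(2)] g(2) by simp
  qed
next
  assume down: "\<forall>u. cov u p \<longrightarrow> f (u, i) < f (p, i) - 1"
  define g where "g = (\<lambda>(q, j). if q = p \<and> 1 \<le> j \<and> j \<le> i then min (f (p, j)) (f (p, i) - 1) else f (q, j))"
  have "g \<in> L"
  proof (rule labelingsI)
    show "g \<in> extensional (P \<times> {1..l})"
      using f p i by (auto simp: labelings_def extensional_def g_def)
  next
    fix q j assume "q \<in> P" "j \<in> {1..l}"
    then show "lo q \<le> g (q, j) \<and> g (q, j) \<le> hi q"
      using labelingsD(1,2)[OF f, of q j] less by (auto simp: g_def)
  next
    fix q j j' assume "q \<in> P" "j \<in> {1..l}" "j' \<in> {1..l}" "j \<le> j'"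
    then show "g (q, j) \<le> g (q, j')"
      using labelingsD(3)[OF f, of q j j'] by (auto simp: g_def)
  next
    fix q u j assume q: "cov q u" "j \<in> {1..l}"
    then have "f (q, j) < f (u, j)" "q \<noteq> u"
      using labelingsD(4)[OF f, of q j u] cov_less by auto
    moreover have "f (q, j) < f (p, i) - 1" if "u = p" "j \<le> i"
      using down q i that labelingsD(3)[OF f, of q j i] cov_less[OF q(1)] by fastforce
    ultimately show "g (q, j) < g (u, j)"
      by (auto simp: g_def)
  qed
  then show "lowerable P l R f p i"
    using i by (auto simp: lowerable_def agree_off_fiber_def g_def intro!: bexI[of _ g])
qed

text \<open>With \<open>c\<close> the count at \<open>(p, k)\<close> and \<open>A\<close>,
  \<open>B\<close> its bounds, the free layers are those in \<open>(A, c]\<close> with label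
  \<open>k\<close> and those in \<open>(c, B]\<close> with label \<open>k + 1\<close>. Exchanging
  their multiplicities puts \<open>k\<close> on the first \<open>B - c\<close> layers after
  \<open>A\<close>, so the count becomes \<open>A + B - c\<close>.\<close>

lemma represents_bender_knuth:
  assumes f: "f \<in> L" and s: "s \<in> S" and rep: "represents f s"
  shows "represents (bender_knuth P l R k f) (toggle_set E (int l) {x \<in> Q. snd x = k} s)"
    (is "represents ?f ?s")
  unfolding represents_def
proof (intro conjI ballI allI)
  show "?f \<in> extensional (P \<times> {1..l})"
    using f by (auto simp: labelings_def extensional_def bender_knuth_def Let_def
        free_low_def free_high_def)
next
  fix p i k' assume p: "p \<in> P" and i: "i \<in> {1..l}"
  let ?lo = "free_low P l R k f p" and ?hi = "free_high P l R k f p"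
  have level_le: "f (q, j) \<le> m \<longleftrightarrow> int j \<le> level s q m" if "q \<in> P" "j \<in> {1..l}" for q j m
    using represents_iff[OF rep that] .
  show "?f (p, i) \<le> k' \<longleftrightarrow> int i \<le> level ?s p k'"
  proof (cases "(p, k) \<in> Q")
    \<comment> \<open>Outside the cells, \<open>k\<close> and a larger label are not both in
      \<open>R p\<close>, so the fiber has no free label.\<close>
    case False
    then have "level ?s p k' = level s p k'"
      by (auto simp: level_def toggle_set_def cells_def)
    moreover have "?f (p, i) = f (p, i)"
      using False p R_eq[OF p] by (auto simp: bender_knuth_def free_low_def free_high_def cells_def Let_def)
    ultimately show ?thesis
      using level_le[OF p i] by simp
  next
    case True
    then have k: "lo p \<le> k" "k < hi p"
      by (auto simp: cells_def)
    define A where "A = Max (insert 0 (s ` {y. E (p, k) y}))"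
    define B where "B = Min (insert (int l) (s ` {y. E y (p, k)}))"
    define c where "c = s (p, k)"
    have c: "level s p k = c" "A \<le> c" "c \<le> B"
      using bounds_of_partition[OF s True] level_cell[OF True] by (simp_all add: A_def B_def c_def)
    have AB: "0 \<le> A" "B \<le> int l"
      using finite_neighbours by (auto simp: A_def B_def)
    have level': "level ?s p m = (if m = k then A + B - c else level s p m)" for m
      using True k by (auto simp: level_def toggle_set_def A_def B_def c_def cells_def)
    have next_k: "next_label R p k = k + 1"
      unfolding next_label_def using R_eq[OF p] k
      by (intro Min_eqI) (auto intro: finite_subset[of _ "{lo p..hi p}"])
    \<comment> \<open>The missing neighbours on this side have forced count 0, so they satisfy the
      inequality and \<open>level\<close> may replace \<open>s\<close>. In \<open>le_B\<close>
      below, the missing neighbours have forced count \<open>l\<close>.\<close>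
    have A_less: "A < int j \<longleftrightarrow> level s p (k - 1) < int j \<and> (\<forall>u. cov p u \<longrightarrow> level s u (k + 1) < int j)"
      if "j \<in> {1..l}" for j
    proof -
      have "A < int j \<longleftrightarrow> (\<forall>y. E (p, k) y \<longrightarrow> s y < int j)"
        using that finite_neighbours by (auto simp: A_def)
      also have "\<dots> \<longleftrightarrow> ((p, k - 1) \<in> Q \<longrightarrow> s (p, k - 1) < int j) \<and>
          (\<forall>u. cov p u \<longrightarrow> (u, k + 1) \<in> Q \<longrightarrow> s (u, k + 1) < int j)"
        using True by (auto simp: cell_edge_def)
      also have "\<dots> \<longleftrightarrow> level s p (k - 1) < int j \<and> (\<forall>u. cov p u \<longrightarrow> level s u (k + 1) < int j)"
      proof -
        have "((p, k - 1) \<in> Q \<longrightarrow> s (p, k - 1) < int j) \<longleftrightarrow> level s p (k - 1) < int j"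
          using that p k by (auto simp: level_def cells_def)
        moreover have "((u, k + 1) \<in> Q \<longrightarrow> s (u, k + 1) < int j) \<longleftrightarrow> level s u (k + 1) < int j"
          if "cov p u" for u
          using \<open>j \<in> {1..l}\<close> k cov_less[OF that] hi_less[of p u] by (auto simp: level_def cells_def)
        ultimately show ?thesis
          by blast
      qed
      finally show ?thesis .
    qed
    have le_B: "int j \<le> B \<longleftrightarrow> int j \<le> level s p (k + 1) \<and> (\<forall>u. cov u p \<longrightarrow> int j \<le> level s u (k - 1))"
      if "j \<in> {1..l}" for j
    proof -
      have "int j \<le> B \<longleftrightarrow> (\<forall>y. E y (p, k) \<longrightarrow> int j \<le> s y)"
        using that finite_neighbours by (auto simp: B_def)
      also have "\<dots> \<longleftrightarrow> ((p, k + 1) \<in> Q \<longrightarrow> int j \<le> s (p, k + 1)) \<and>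
          (\<forall>u. cov u p \<longrightarrow> (u, k - 1) \<in> Q \<longrightarrow> int j \<le> s (u, k - 1))"
        using True by (force simp: cell_edge_def)
      also have "\<dots> \<longleftrightarrow> int j \<le> level s p (k + 1) \<and> (\<forall>u. cov u p \<longrightarrow> int j \<le> level s u (k - 1))"
      proof -
        have "((p, k + 1) \<in> Q \<longrightarrow> int j \<le> s (p, k + 1)) \<longleftrightarrow> int j \<le> level s p (k + 1)"
          using that p k by (auto simp: level_def cells_def)
        moreover have "((u, k - 1) \<in> Q \<longrightarrow> int j \<le> s (u, k - 1)) \<longleftrightarrow> int j \<le> level s u (k - 1)"
          if "cov u p" for u
          using \<open>j \<in> {1..l}\<close> k cov_less[OF that] lo_less[of u p] by (auto simp: level_def cells_def)
        ultimately show ?thesis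
          by blast
      qed
      finally show ?thesis .
    qed
    have R: "k \<in> R p" "\<exists>r\<in>R p. k < r"
      using R_eq[OF p] k by auto
    have low: "?lo = {j \<in> {1..l}. A < int j \<and> int j \<le> c}"
    proof -
      have "f (p, j) = k \<and> raisable P l R f p j \<longleftrightarrow> A < int j \<and> int j \<le> c" if j: "j \<in> {1..l}" for j
      proof -
        have "f (p, j) = k \<longleftrightarrow> int j \<le> c \<and> level s p (k - 1) < int j"
          using level_le[OF p j, of k] level_le[OF p j, of "k - 1"] c(1) by auto
        moreover have "raisable P l R f p j \<longleftrightarrow> (\<forall>u. cov p u \<longrightarrow> level s u (k + 1) < int j)" if "f (p, j) = k"
          using raisable_iff[OF f p j] that k cov_less level_le[OF _ j, of _ "k + 1"]
          by (auto simp: not_le[symmetric])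
        ultimately show ?thesis
          using A_less[OF j] by blast
      qed
      then show ?thesis
        using R by (auto simp: free_low_def)
    qed
    have high: "?hi = {j \<in> {1..l}. c < int j \<and> int j \<le> B}"
    proof -
      have "f (p, j) = k + 1 \<and> lowerable P l R f p j \<longleftrightarrow> c < int j \<and> int j \<le> B" if j: "j \<in> {1..l}" for j
      proof -
        have "f (p, j) = k + 1 \<longleftrightarrow> int j \<le> level s p (k + 1) \<and> c < int j"
          using level_le[OF p j, of k] level_le[OF p j, of "k + 1"] c(1) by auto
        moreover have "lowerable P l R f p j \<longleftrightarrow> (\<forall>u. cov u p \<longrightarrow> int j \<le> level s u (k - 1))"
          if "f (p, j) = k + 1"
          using lowerable_iff[OF f p j] that k cov_less level_le[OF _ j, of _ "k - 1"] by auto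
        ultimately show ?thesis
          using le_B[OF j] by blast
      qed
      then show ?thesis
        using R next_k by (auto simp: free_high_def)
    qed
    have free: "?lo \<union> ?hi = {nat A + 1..nat B}"
      unfolding low high using c AB by auto
    have card_high: "card ?hi = nat (B - c)"
    proof -
      have "?hi = {nat c + 1..nat B}"
        unfolding high using c AB by auto
      then show ?thesis
        using c AB by (simp add: nat_diff_distrib)
    qed
    have f': "?f (p, i) = (if A < int i \<and> int i \<le> B then (if int i \<le> A + B - c then k else k + 1) else f (p, i))"
    proof (cases "i \<in> {nat A + 1..nat B}")
      case True
      then have "{j \<in> {nat A + 1..nat B}. j < i} = {nat A + 1..<i}"
        by auto
      \<comment> \<open>There are \<open>i - 1 - nat A\<close> free layers before \<open>i\<close>;
        this is below \<open>B - c\<close> exactly if \<open>i\<close> is at most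
        \<open>A + B - c\<close>.\<close>
      then have "card {j \<in> ?lo \<union> ?hi. j < i} = i - 1 - nat A"
        unfolding free by simp
      moreover have "A < int i" "int i \<le> B"
        using True AB by auto
      ultimately show ?thesis
        using True p AB c by (auto simp: bender_knuth_def Let_def free card_high next_k simp del: Un_iff)
    next
      case False
      then show ?thesis
        using AB p by (auto simp: bender_knuth_def Let_def free simp del: Un_iff)
    qed
    show ?thesis
    proof (cases "A < int i \<and> int i \<le> B")
      case True
      \<comment> \<open>A free label is \<open>k\<close> or \<open>k + 1\<close> before and after,
        so only the comparison with threshold \<open>k\<close> can change.\<close>
      have "level s p (k - 1) < int i" "int i \<le> level s p (k + 1)"
        using True A_less[OF i] le_B[OF i] by auto
      then have "k' < k \<Longrightarrow> level s p k' < int i" "k < k' \<Longrightarrow> int i \<le> level s p k'"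
        using level_mono[OF s p, of k' "k - 1"] level_mono[OF s p, of "k + 1" k'] by auto
      then show ?thesis
        using True f' level' by (cases k' k rule: linorder_cases) auto
    next
      \<comment> \<open>A layer at most \<open>A\<close> is at most both \<open>c\<close> and
        \<open>A + B - c\<close>, and a layer above \<open>B\<close> exceeds both.\<close>
      case False
      then show ?thesis
        using f' level' level_le[OF p i, of k'] c by auto
    qed
  qed
qed

lemma to_partition_bender_knuth:
  assumes "f \<in> L"
  shows "bender_knuth P l R k f \<in> L"
    "to_partition (bender_knuth P l R k f) =
      toggle_set E (int l) {x \<in> Q. snd x = k} (to_partition f)"
proof -
  let ?s = "toggle_set E (int l) {x \<in> Q. snd x = k} (to_partition f)"
  have s: "?s \<in> S"
    using represents_to_partition(2)[OF assms]
    by (intro toggle_set_partition) (auto simp: cell_edge_def)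
  have rep: "represents (bender_knuth P l R k f) ?s"
    using represents_bender_knuth represents_to_partition assms by blast
  show f': "bender_knuth P l R k f \<in> L"
    using represents_labeling[OF s rep] .
  show "to_partition (bender_knuth P l R k f) = ?s"
    using represents_unique_partition[OF _ rep] represents_to_partition[OF f'] s by blast
qed

text \<open>The height function of promotion is the threshold \<open>snd\<close>. Any interval
  containing all labels serves, which allows both problems to use translates of one
  interval.\<close>

lemma to_partition_promotion:
  assumes f: "f \<in> L" and range: "(\<Union>p\<in>P. R p) \<subseteq> {m..n}"
  shows "promotion P l R f \<in> L"
    "to_partition (promotion P l R f) = sweep Q E (int l) snd [m..n] (to_partition f)"
proof -
  have "fold (bender_knuth P l R) ks g \<in> L \<and> to_partition (fold (bender_knuth P l R) ks g) =
      sweep Q E (int l) snd ks (to_partition g)" if "g \<in> L" for ks g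
    using that
  proof (induction ks arbitrary: g)
    case (Cons k ks)
    then show ?case
      using to_partition_bender_knuth[OF Cons.prems, of k] by (simp add: sweep_def)
  qed (simp add: sweep_def)
  moreover have "promotion P l R f = fold (bender_knuth P l R) [m..n] f"
    using promotion_eq_fold[OF _ range] by simp
  ultimately show "promotion P l R f \<in> L"
    "to_partition (promotion P l R f) = sweep Q E (int l) snd [m..n] (to_partition f)"
    using f by auto
qed

end

section \<open>The rectangle and the triangle\<close>

definition order_convex :: "'a::order set \<Rightarrow> bool" where
  "order_convex P \<longleftrightarrow> (\<forall>p\<in>P. \<forall>q\<in>P. \<forall>r. p \<le> r \<longrightarrow> r \<le> q \<longrightarrow> r \<in> P)"

text \<open>In an order-convex set of grid points these unit steps are the covering
  relation.\<close>

definition grid_step :: "(nat \<times> nat) set \<Rightarrow> nat \<times> nat \<Rightarrow> nat \<times> nat \<Rightarrow> bool" where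
  "grid_step P p q \<longleftrightarrow> p \<in> P \<and> q \<in> P \<and>
     (q = (Suc (fst p), snd p) \<or> q = (fst p, Suc (snd p)))"

lemma nat_pair_less_iff:
  fixes x y x' y' :: nat
  shows "(x, y) < (x', y') \<longleftrightarrow> x \<le> x' \<and> y \<le> y' \<and> x + y < x' + y'"
  by (auto simp: less_le)

lemma grid_step_less: "grid_step P p q \<Longrightarrow> p < q"
  by (cases p) (auto simp: grid_step_def less_le)

lemma grid_step_above:
  assumes P: "order_convex P" "p \<in> P" "q \<in> P" and less: "p < q"
  shows "\<exists>u. grid_step P p u \<and> u \<le> q"
proof -
  obtain i j i' j' where pq: "p = (i, j)" "q = (i', j')"
    by fastforce
  then consider "i < i'" "j \<le> j'" | "j < j'" "i \<le> i'"
    using less by (auto simp: less_le)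
  then show ?thesis
  proof cases
    case 1
    then have "(Suc i, j) \<in> P"
      using P pq by (auto simp: order_convex_def)
    then show ?thesis
      using P pq 1 by (intro exI[of _ "(Suc i, j)"]) (auto simp: grid_step_def)
  next
    case 2
    then have "(i, Suc j) \<in> P"
      using P pq by (auto simp: order_convex_def)
    then show ?thesis
      using P pq 2 by (intro exI[of _ "(i, Suc j)"]) (auto simp: grid_step_def)
  qed
qed

lemma grid_step_below:
  assumes P: "order_convex P" "p \<in> P" "q \<in> P" and less: "p < q"
  shows "\<exists>u. grid_step P u q \<and> p \<le> u"
proof -
  obtain i j i' j' where pq: "p = (i, j)" "q = (i', j')"
    by fastforce
  then consider "i < i'" "j \<le> j'" | "j < j'" "i \<le> i'"
    using less by (auto simp: less_le)
  then show ?thesis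
  proof cases
    case 1
    then have "(i' - 1, j') \<in> P"
      using P pq by (auto simp: order_convex_def)
    then show ?thesis
      using P pq 1 by (intro exI[of _ "(i' - 1, j')"]) (auto simp: grid_step_def)
  next
    case 2
    then have "(i', j' - 1) \<in> P"
      using P pq by (auto simp: order_convex_def)
    then show ?thesis
      using P pq 2 by (intro exI[of _ "(i', j' - 1)"]) (auto simp: grid_step_def)
  qed
qed

text \<open>Order convexity gives a chain of unit steps from \<open>p\<close> to \<open>q\<close>
  inside \<open>P\<close>, and \<open>g\<close> grows by at least 1 on each.\<close>

lemma strict_mono_grid_diff:
  fixes g :: "nat \<times> nat \<Rightarrow> int"
  assumes P: "order_convex P" and q: "q \<in> P"
    and g: "\<forall>p1\<in>P. \<forall>p2\<in>P. p1 < p2 \<longrightarrow> g p1 < g p2"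
  shows "p \<in> P \<Longrightarrow> p \<le> q \<Longrightarrow>
    g p + (int (fst q) - int (fst p)) + (int (snd q) - int (snd p)) \<le> g q"
proof (induction "fst q + snd q - fst p - snd p" arbitrary: p rule: less_induct)
  case less
  show ?case
  proof (cases "p = q")
    case False
    then obtain u where u: "grid_step P p u" "u \<le> q"
      using grid_step_above[OF P less.prems(1) q] less.prems(2) by (metis order.not_eq_order_implies_strict)
    then have "u \<in> P" "g p < g u"
      using g grid_step_less[OF u(1)] less.prems(1) by (auto simp: grid_step_def simp del: split_paired_All)
    moreover have "int (fst u) + int (snd u) = int (fst p) + int (snd p) + 1"
      using u(1) by (auto simp: grid_step_def)
    moreover have "fst u \<le> fst q" "snd u \<le> snd q"
      using u(2) by (auto simp: less_eq_prod_def)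
    ultimately show ?thesis
      using less.hyps[of u] u(2) by fastforce
  qed simp
qed

section \<open>The restriction functions as intervals\<close>

lemma order_convex_rectangle: "order_convex ({1..a} \<times> {1..b} :: (nat \<times> nat) set)"
  by (auto simp: order_convex_def)

lemma order_convex_triangle: "order_convex (triangle a)"
  by (auto simp: order_convex_def triangle_def)

text \<open>The chain from \<open>(1, 1)\<close> gives the lower end and the chain to
  \<open>(i, b)\<close>, bounded there by \<open>\<beta>\<close>, the upper end.\<close>

lemma restriction_rectangle:
  assumes i: "i \<in> {1..a}" and j: "j \<in> {1..b}"
    and \<beta>: "\<And>i j. i \<in> {1..a} \<Longrightarrow> j \<in> {1..b} \<Longrightarrow> \<beta> (i, j) = int b + 2 * int i - 1"
  shows "restriction ({1..a} \<times> {1..b}) \<beta> (i, j) = {int i + int j - 1..2 * int i + int j - 1}"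
proof (intro set_eqI iffI)
  fix k assume "k \<in> restriction ({1..a} \<times> {1..b}) \<beta> (i, j)"
  then obtain g :: "nat \<times> nat \<Rightarrow> int"
    where mono: "\<forall>p1\<in>{1..a} \<times> {1..b}. \<forall>p2\<in>{1..a} \<times> {1..b}. p1 < p2 \<longrightarrow> g p1 < g p2"
      and range: "\<forall>p\<in>{1..a} \<times> {1..b}. 1 \<le> g p \<and> g p \<le> \<beta> p" and k: "g (i, j) = k"
    by (auto simp: restriction_def)
  note diff = strict_mono_grid_diff[OF order_convex_rectangle _ mono]
  have "1 \<le> g (1, 1)" "g (i, b) \<le> int b + 2 * int i - 1"
    using range[rule_format, of "(1, 1)"] range[rule_format, of "(i, b)"] i j \<beta>[of i b] by auto
  then show "k \<in> {int i + int j - 1..2 * int i + int j - 1}"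
    using diff[of "(i, j)" "(1, 1)"] diff[of "(i, b)" "(i, j)"] i j k by auto
next
  fix k assume k: "k \<in> {int i + int j - 1..2 * int i + int j - 1}"
  \<comment> \<open>The surplus over the minimal labeling is the first coordinate, truncated at the
    surplus wanted at \<open>(i, j)\<close>; the truncation preserves strictness.\<close>
  let ?g = "\<lambda>(x, y). int x + int y - 1 + min (int x) (k - (int i + int j - 1))"
  show "k \<in> restriction ({1..a} \<times> {1..b}) \<beta> (i, j)"
    unfolding restriction_def mem_Collect_eq
  proof (intro exI[of _ ?g] conjI ballI impI)
    fix p q :: "nat \<times> nat" assume "p < q"
    then show "?g p < ?g q"
      by (cases p; cases q) (simp add: nat_pair_less_iff, linarith)
  next
    fix p assume "p \<in> {1..a} \<times> {1..b}"
    then show "1 \<le> ?g p" "?g p \<le> \<beta> p"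
      using k by (auto simp: \<beta>)
  qed (use k in auto)
qed

text \<open>The chains to \<open>(i, j)\<close> from the lowest point of its row and from
  \<open>(i, j)\<close> to the top \<open>(a, a)\<close> give the ends; translates of the rank
  function attain everything between.\<close>

lemma restriction_triangle:
  assumes ij: "(i, j) \<in> triangle a"
  shows "restriction (triangle a) (\<lambda>_. int a + int b) (i, j) =
    {int i + int j - int a..int b + int i + int j - int a}"
proof (intro set_eqI iffI)
  fix k assume "k \<in> restriction (triangle a) (\<lambda>_. int a + int b) (i, j)"
  then obtain g :: "nat \<times> nat \<Rightarrow> int"
    where mono: "\<forall>p1\<in>triangle a. \<forall>p2\<in>triangle a. p1 < p2 \<longrightarrow> g p1 < g p2"
      and range: "\<forall>p\<in>triangle a. 1 \<le> g p \<and> g p \<le> int a + int b" and k: "g (i, j) = k"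
    by (auto simp: restriction_def)
  note diff = strict_mono_grid_diff[OF order_convex_triangle _ mono]
  have corners: "(i, a + 1 - i) \<in> triangle a" "(a, a) \<in> triangle a"
    using ij by (auto simp: triangle_def)
  then have "1 \<le> g (i, a + 1 - i)" "g (a, a) \<le> int a + int b"
    using range by blast+
  moreover have "1 \<le> i" "i \<le> a" "j \<le> a" "a + 1 - i \<le> j"
    using ij by (auto simp: triangle_def)
  ultimately show "k \<in> {int i + int j - int a..int b + int i + int j - int a}"
    using diff[OF ij corners(1)] diff[OF corners(2) ij] k by (simp add: of_nat_diff)
next
  fix k assume k: "k \<in> {int i + int j - int a..int b + int i + int j - int a}"
  let ?g = "\<lambda>(x, y). int x + int y + (k - int i - int j)"
  show "k \<in> restriction (triangle a) (\<lambda>_. int a + int b) (i, j)"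
    unfolding restriction_def mem_Collect_eq
  proof (intro exI[of _ ?g] conjI ballI impI)
    fix p q :: "nat \<times> nat" assume "p < q"
    then show "?g p < ?g q"
      by (cases p; cases q) (simp add: nat_pair_less_iff)
  next
    fix p assume "p \<in> triangle a"
    then show "1 \<le> ?g p" "?g p \<le> int a + int b"
      using k by (auto simp: triangle_def)
  qed simp
qed

lemma map_add_upto: "map (\<lambda>k. k + c) [m..n] = [m + c..n + (c::int)]"
  by (rule nth_equalityI) auto

text \<open>
  Both sets of cells are the product of the triangle, with coordinates \<open>x\<close>, \<open>y\<close>, and a chain, with
  coordinate \<open>z\<close>.  The threshold is \<open>a + x - y + z - 1\<close> in the rectangle, where \<open>z\<close> is the second
  coordinate of the point, and \<open>b - a + x + y - z\<close> in the triangle.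
\<close>

definition cell_iso :: "nat \<Rightarrow> nat \<Rightarrow> (nat \<times> nat) \<times> int \<Rightarrow> (nat \<times> nat) \<times> int" where
  "cell_iso a b = (\<lambda>((x, y), k). ((x, nat (int b + int x + int y - int a - k)), int b + 2 * int x - 1 - k))"

abbreviation "rect_lo \<equiv> \<lambda>(i, j). int i + int j - 1"
abbreviation "rect_hi \<equiv> \<lambda>(i, j). 2 * int i + int j - 1"
abbreviation "tri_lo a \<equiv> \<lambda>(i, j). int i + int j - int a"
abbreviation "tri_hi a b \<equiv> \<lambda>(i, j). int b + int i + int j - int a"

lemma bij_betw_cell_iso:
  "bij_betw (cell_iso a b) (cells (triangle a) (tri_lo a) (tri_hi a b))
     (cells ({1..a} \<times> {1..b}) rect_lo rect_hi)" (is "bij_betw _ ?T ?C")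
proof (rule bij_betw_byWitness)
  \<comment> \<open>The second coordinate solves the threshold formula
    \<open>k = a + x - y + z - 1\<close> of the rectangle for \<open>y\<close>.\<close>
  let ?inv = "\<lambda>((x, z), k). ((x, nat (int a + int x + int z - 1 - k)), int b + 2 * int x - 1 - k)"
  have T: "((x, y), k) \<in> ?T \<longleftrightarrow> 1 \<le> x \<and> x \<le> a \<and> y \<le> a \<and> int a + 1 \<le> int x + int y \<and>
      int x + int y - int a \<le> k \<and> k < int b + int x + int y - int a" for x y k
    unfolding cells_def triangle_def by simp linarith
  have C: "((x, z), k) \<in> ?C \<longleftrightarrow> 1 \<le> x \<and> x \<le> a \<and> 1 \<le> z \<and> z \<le> b \<and>
      int x + int z - 1 \<le> k \<and> k < 2 * int x + int z - 1" for x z k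
    by (simp add: cells_def)
  show "\<forall>q\<in>?T. ?inv (cell_iso a b q) = q"
    by (clarsimp simp: T cell_iso_def simp del: One_nat_def)
  show "\<forall>q\<in>?C. cell_iso a b (?inv q) = q"
    by (clarsimp simp: C cell_iso_def simp del: One_nat_def)
  show "cell_iso a b ` ?T \<subseteq> ?C"
    by (clarsimp simp: T C cell_iso_def simp del: One_nat_def) linarith
  show "?inv ` ?C \<subseteq> ?T"
    by (clarsimp simp: T C simp del: One_nat_def) linarith
qed

text \<open>The isomorphism interchanges two kinds of edges: a drop of the threshold in one poset is
  a step in the second coordinate in the other. Steps in the first coordinate keep their
  kind.\<close>

lemma cell_edge_cell_iso:
  assumes "q \<in> cells (triangle a) (tri_lo a) (tri_hi a b)" and "r \<in> cells (triangle a) (tri_lo a) (tri_hi a b)"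
  shows "cell_edge (triangle a) (tri_lo a) (tri_hi a b) (grid_step (triangle a)) q r \<longleftrightarrow>
    cell_edge ({1..a} \<times> {1..b}) rect_lo rect_hi (grid_step ({1..a} \<times> {1..b})) (cell_iso a b q) (cell_iso a b r)"
proof -
  have iso: "cell_iso a b q \<in> cells ({1..a} \<times> {1..b}) rect_lo rect_hi"
    "cell_iso a b r \<in> cells ({1..a} \<times> {1..b}) rect_lo rect_hi"
    using bij_betw_apply[OF bij_betw_cell_iso] assms by blast+
  obtain x y k x' y' k' where qr: "q = ((x, y), k)" "r = ((x', y'), k')"
    by (metis surj_pair)
  define z z' where "z = nat (int b + int x + int y - int a - k)"
    and "z' = nat (int b + int x' + int y' - int a - k')"
  have z: "int z = int b + int x + int y - int a - k" "int z' = int b + int x' + int y' - int a - k'"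
    using assms by (auto simp: qr z_def z'_def cells_def)
  have fst: "(x, y) \<in> triangle a" "(x', y') \<in> triangle a" "(x, z) \<in> {1..a} \<times> {1..b}" "(x', z') \<in> {1..a} \<times> {1..b}"
    using assms iso by (auto simp: qr cells_def cell_iso_def z_def z'_def)
  have "(x' = x \<and> y' = y \<and> k' = k - 1 \<or> (x' = Suc x \<and> y' = y \<or> x' = x \<and> y' = Suc y) \<and> k' = k + 1) \<longleftrightarrow>
    (x' = x \<and> z' = z \<and> int b + 2 * int x' - 1 - k' = int b + 2 * int x - 1 - k - 1 \<or>
     (x' = Suc x \<and> z' = z \<or> x' = x \<and> z' = Suc z) \<and>
      int b + 2 * int x' - 1 - k' = int b + 2 * int x - 1 - k + 1)"
    using z by linarith
  moreover have "cell_iso a b q = ((x, z), int b + 2 * int x - 1 - k)"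
    "cell_iso a b r = ((x', z'), int b + 2 * int x' - 1 - k')"
    by (simp_all add: qr cell_iso_def z_def z'_def)
  ultimately show ?thesis
    using assms iso fst unfolding cell_edge_def grid_step_def qr by simp
qed

theorem theorem4p6:
  fixes a b l :: nat and \<beta> :: "nat \<times> nat \<Rightarrow> int"
  assumes "a > 0" and "b > 0" and "l > 0"
    and "\<And>i j. i \<in> {1..a} \<Longrightarrow> j \<in> {1..b} \<Longrightarrow> \<beta> (i, j) = int b + 2 * int i - 1"
  shows "\<exists>\<Psi>. bij_betw \<Psi>
      (labelings ({1..a} \<times> {1..b}) l (restriction ({1..a} \<times> {1..b}) \<beta>))
      (labelings (triangle a) l (restriction (triangle a) (\<lambda>_. int a + int b))) \<and>
    (\<forall>f \<in> labelings ({1..a} \<times> {1..b}) l (restriction ({1..a} \<times> {1..b}) \<beta>).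
      \<Psi> (promotion ({1..a} \<times> {1..b}) l (restriction ({1..a} \<times> {1..b}) \<beta>) f) =
      promotion (triangle a) l (restriction (triangle a) (\<lambda>_. int a + int b)) (\<Psi> f))"
proof -
  let ?C = "{1..a} \<times> {1..b}" and ?T = "triangle a"
  let ?RC = "restriction ?C \<beta>" and ?RT = "restriction ?T (\<lambda>_. int a + int b)"
  have RC: "?RC p = {rect_lo p..rect_hi p}" if "p \<in> ?C" for p
    using restriction_rectangle[of "fst p" a "snd p" b \<beta>, OF _ _ assms(4)] that by (cases p) simp
  have RT: "?RT p = {tri_lo a p..tri_hi a b p}" if "p \<in> ?T" for p
    using restriction_triangle[of "fst p" "snd p" a b] that by (cases p) simp
  have fin: "finite ?T"
    by (rule finite_subset[of _ "{1..a} \<times> {1..a}"]) (auto simp: triangle_def)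
  interpret C: interval_labelings ?C ?RC rect_lo rect_hi "grid_step ?C" l
    by (unfold_locales; (fact RC grid_step_above[OF order_convex_rectangle]
      grid_step_below[OF order_convex_rectangle])?)
      (auto simp: less_le grid_step_def)
  interpret T: interval_labelings ?T ?RT "tri_lo a" "tri_hi a b" "grid_step ?T" l
    by (unfold_locales; (fact fin RT grid_step_above[OF order_convex_triangle]
      grid_step_below[OF order_convex_triangle])?)
      (auto simp: less_le grid_step_def)
  \<comment> \<open>The translation \<open>c\<close> makes \<open>h q + c\<close> exceed
    \<open>snd q\<close> by an even nonnegative number on the cells. The bound \<open>n\<close>
    equals \<open>c + a + b\<close>, so that \<open>n - c\<close> is the largest label allowed in
    the triangle.\<close>
  define c n :: int where "c = int b + 1 + 2 * int a" and "n = 3 * int a + 2 * int b + 1"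
  \<comment> \<open>\<open>h\<close> is the threshold of the triangle, read off from the
    corresponding cell of the rectangle.\<close>
  define h :: "(nat \<times> nat) \<times> int \<Rightarrow> int"
    where "h = (\<lambda>((x, z), k). int b + 2 * int x - 1 - k)"
  define \<tau> where "\<tau> = (\<lambda>s::(nat \<times> nat) \<times> int \<Rightarrow> int. restrict (s \<circ> cell_iso a b) T.Q)"
  have C_step: "\<bar>snd q - snd r\<bar> = 1" "\<bar>(h q + c) - (h r + c)\<bar> = 1" if "C.E q r" for q r
    using that by (auto simp: cell_edge_def grid_step_def h_def split: prod.splits)
  define d :: "(nat \<times> nat) \<times> int \<Rightarrow> nat"
    where "d = (\<lambda>((x, z), k). nat (int a + int b + int x - k))"
  have "\<exists>\<phi>. bij_betw \<phi> C.S C.S \<and>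
      (\<forall>s. \<phi> (sweep C.Q C.E (int l) snd [0..n] s) =
        sweep C.Q C.E (int l) (\<lambda>q. h q + c) [0..n] (\<phi> s))"
  proof (rule C.sweeps_conjugate[where d = d])
    fix q assume "q \<in> C.Q"
    then show "h q + c = snd q + 2 * int (d q)" "0 \<le> snd q" "h q + c \<le> n"
      by (auto simp: cells_def h_def d_def c_def n_def)
  qed (fact C_step)+
  then obtain \<phi> where \<phi>: "bij_betw \<phi> C.S C.S"
    "\<And>s. \<phi> (sweep C.Q C.E (int l) snd [0..n] s) =
      sweep C.Q C.E (int l) (\<lambda>q. h q + c) [0..n] (\<phi> s)"
    by blast
  note transport = transport_sweep[where \<theta> = "cell_iso a b" and E = C.E and E' = T.E,
      OF bij_betw_cell_iso cell_edge_cell_iso C.edge_vertices T.edge_vertices]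
  have \<tau>: "bij_betw \<tau> C.S T.S"
    "\<tau> (sweep C.Q C.E (int l) h ks s) = sweep T.Q T.E (int l) (h \<circ> cell_iso a b) ks (\<tau> s)" for ks s
    unfolding \<tau>_def by (rule transport; assumption)+
  have h_iso: "h \<circ> cell_iso a b = snd"
    by (auto simp: h_def cell_iso_def)
  have shift: "sweep C.Q C.E (int l) (\<lambda>q. h q + c) [0..n] s = sweep C.Q C.E (int l) h [0 - c..n - c] s" for s
    using sweep_shift[of C.Q C.E "int l" h c "[0 - c..n - c]"] by (simp add: map_add_upto)
  \<comment> \<open>Pass to counts, change the height function from \<open>snd\<close> to
    \<open>h + c\<close>, move the cells to the triangle, and return to labelings.\<close>
  define \<Psi> where "\<Psi> = inv_into T.L T.to_partition \<circ> (\<tau> \<circ> (\<phi> \<circ> C.to_partition))"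
  have \<Psi>: "bij_betw \<Psi> C.L T.L"
    unfolding \<Psi>_def
    by (intro bij_betw_trans[OF _ bij_betw_inv_into[OF T.bij_betw_to_partition]]
        bij_betw_trans[OF _ \<tau>(1)] bij_betw_trans[OF C.bij_betw_to_partition] \<phi>(1))
  have "\<Psi> (promotion ?C l ?RC f) = promotion ?T l ?RT (\<Psi> f)" if f: "f \<in> C.L" for f
  proof -
    have \<Psi>f: "\<Psi> f \<in> T.L"
      using \<Psi> f by (rule bij_betw_apply)
    have "\<tau> (\<phi> (C.to_partition f)) \<in> T.S"
      by (intro bij_betw_apply[OF \<tau>(1)] bij_betw_apply[OF \<phi>(1)]
          bij_betw_apply[OF C.bij_betw_to_partition] f)
    then have to_\<Psi>: "T.to_partition (\<Psi> f) = \<tau> (\<phi> (C.to_partition f))"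
      using bij_betw_inv_into_right[OF T.bij_betw_to_partition] by (simp add: \<Psi>_def)
    have range: "(\<Union>p\<in>?C. ?RC p) \<subseteq> {0..n}" "(\<Union>p\<in>?T. ?RT p) \<subseteq> {0 - c..n - c}"
    proof -
      have "?RC p \<subseteq> {0..n}" if "p \<in> ?C" for p
        using RC[OF that] that by (cases p) (auto simp: n_def)
      moreover have "?RT p \<subseteq> {0 - c..n - c}" if "p \<in> ?T" for p
        using RT[OF that] that by (cases p) (auto simp: n_def c_def triangle_def[of a])
      ultimately show "(\<Union>p\<in>?C. ?RC p) \<subseteq> {0..n}" "(\<Union>p\<in>?T. ?RT p) \<subseteq> {0 - c..n - c}"
        by blast+
    qed
    note T_pro = T.to_partition_promotion[OF \<Psi>f range(2)]
    have "\<tau> (\<phi> (C.to_partition (promotion ?C l ?RC f))) =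
        sweep T.Q T.E (int l) snd [0 - c..n - c] (\<tau> (\<phi> (C.to_partition f)))"
      by (simp only: C.to_partition_promotion(2)[OF f range(1)] \<phi>(2) shift \<tau>(2) h_iso)
    also have "\<dots> = T.to_partition (promotion ?T l ?RT (\<Psi> f))"
      by (simp only: T_pro(2) to_\<Psi>)
    finally show ?thesis
      using bij_betw_inv_into_left[OF T.bij_betw_to_partition T_pro(1)] by (simp add: \<Psi>_def)
  qed
  then show ?thesis
    using \<Psi> by blast
qed

end
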